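(* Let $M_1,\dots,M_q$ be loopless matroids on a common ground set $E$ such that $\beta(M_i)\le 2$ and $M_i$ has property (R) for each $i$. Then the ground set $E$ can be covered by at most $2q+1$ sets each independent in all of $M_1,\dots,M_q$, i.e. $\beta(M_1\cap\dots\cap M_q)\le 2q+1$.
   Context: $\beta(M)$ is the minimum number of independent sets of $M$ covering its ground set. For a matroid with circuit set $\mathcal{C}$ and $X\subseteq E$, $\mathcal{C}[X]$ is the set of circuits contained in $X$. A graph on matroid elements covers a family of circuits if every circuit of the family contains both endpoints of some edge; graphs may have parallel edges. Property (R): for any bases $A,B$ there is a 2-regular graph with vertex set $A\triangle B$ covering $\mathcal{C}[A\cup B]$. *)

theory Defs
  imports Main "HOL-Library.Multiset" "HOL-Library.Extended_Nat"
begin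

locale matroid =
  fixes E :: "'a set" and indep :: "'a set \<Rightarrow> bool"
  assumes finite_ground: "finite E"
    and indep_subset_ground: "indep I \<Longrightarrow> I \<subseteq> E"
    and indep_empty: "indep {}"
    and indep_mono: "indep J \<Longrightarrow> I \<subseteq> J \<Longrightarrow> indep I"
    and augment: "indep I \<Longrightarrow> indep J \<Longrightarrow> card I < card J \<Longrightarrow> \<exists>x\<in>J - I. indep (insert x I)"

definition basis :: "'a set \<Rightarrow> ('a set \<Rightarrow> bool) \<Rightarrow> 'a set \<Rightarrow> bool" where
  "basis E indep B \<longleftrightarrow> B \<subseteq> E \<and> indep B \<and> (\<forall>X. B \<subset> X \<and> X \<subseteq> E \<longrightarrow> \<not> indep X)"

definition circuit :: "'a set \<Rightarrow> ('a set \<Rightarrow> bool) \<Rightarrow> 'a set \<Rightarrow> bool" where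
  "circuit E indep C \<longleftrightarrow> C \<subseteq> E \<and> \<not> indep C \<and> (\<forall>X. X \<subset> C \<longrightarrow> indep X)"

definition circuits_in :: "'a set \<Rightarrow> ('a set \<Rightarrow> bool) \<Rightarrow> 'a set \<Rightarrow> 'a set set" where
  "circuits_in E indep X = {C. circuit E indep C \<and> C \<subseteq> X}"

definition loopless_matroid :: "'a set \<Rightarrow> ('a set \<Rightarrow> bool) \<Rightarrow> bool" where
  "loopless_matroid E indep \<longleftrightarrow> (\<forall>e\<in>E. \<not> circuit E indep {e})"

text \<open>The covering number is stated for an arbitrary independence predicate, since the
  intersection of several matroids need not be a matroid. It is \<open>\<infinity>\<close> when the ground set
  cannot be covered by finitely many independent sets.\<close>

definition covering_number :: "'a set \<Rightarrow> ('a set \<Rightarrow> bool) \<Rightarrow> enat" where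
  "covering_number E indep =
     Inf {enat (card F) | F. finite F \<and> (\<forall>I\<in>F. I \<subseteq> E \<and> indep I) \<and> E \<subseteq> \<Union>F}"

definition common_indep :: "'a set \<Rightarrow> nat \<Rightarrow> (nat \<Rightarrow> 'a set \<Rightarrow> bool) \<Rightarrow> 'a set \<Rightarrow> bool" where
  "common_indep E q indep I \<longleftrightarrow> I \<subseteq> E \<and> (\<forall>i\<in>{1..q}. indep i I)"

text \<open>A graph is given by its vertex set and the multiset of its edges. Multiplicities encode
  parallel edges; an edge has two distinct endpoints, so there are no loop edges.\<close>

definition multigraph :: "'a set \<Rightarrow> 'a set multiset \<Rightarrow> bool" where
  "multigraph V G \<longleftrightarrow> (\<forall>e\<in>#G. \<exists>u\<in>V. \<exists>v\<in>V. u \<noteq> v \<and> e = {u, v})"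

definition degree :: "'a set multiset \<Rightarrow> 'a \<Rightarrow> nat" where
  "degree G v = size {#e \<in># G. v \<in> e#}"

definition two_regular :: "'a set \<Rightarrow> 'a set multiset \<Rightarrow> bool" where
  "two_regular V G \<longleftrightarrow> multigraph V G \<and> (\<forall>v\<in>V. degree G v = 2)"

definition covers :: "'a set multiset \<Rightarrow> 'a set set \<Rightarrow> bool" where
  "covers G \<C> \<longleftrightarrow> (\<forall>C\<in>\<C>. \<exists>e\<in>#G. e \<subseteq> C)"

definition property_R :: "'a set \<Rightarrow> ('a set \<Rightarrow> bool) \<Rightarrow> bool" where
  "property_R E indep \<longleftrightarrow>
     (\<forall>A B. basis E indep A \<and> basis E indep B \<longrightarrow>
        (\<exists>G. two_regular ((A - B) \<union> (B - A)) G \<and> covers G (circuits_in E indep (A \<union> B))))"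

end

theory Submission
  imports Defs
begin

text \<open>Since \<open>\<beta>(M\<^sub>i) \<le> 2\<close>, the ground set is the union of two bases of \<open>M\<^sub>i\<close>, so property (R)
  yields a graph of maximum degree at most 2 covering all circuits of \<open>M\<^sub>i\<close>. The union of these
  graphs has maximum degree at most \<open>2q\<close> and is therefore \<open>(2q + 1)\<close>-colourable. A colour class
  contains no edge, hence no circuit of any \<open>M\<^sub>i\<close>.\<close>

text \<open>Finiteness of \<open>E\<close> gives a maximal element above \<open>I\<close> among the
  independent supersets of \<open>I\<close>. Every superset of it still contains \<open>I\<close>,
  so it is maximal among all independent sets.\<close>

lemma (in matroid) indep_extends_to_basis:
  assumes "indep I"
  obtains B where "basis E indep B" "I \<subseteq> B"
proof -
  have "finite {J. indep J \<and> I \<subseteq> J}"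
    by (rule finite_subset[of _ "Pow E"]) (use finite_ground indep_subset_ground in auto)
  then obtain B where "I \<subseteq> B" "indep B" "\<forall>J. indep J \<and> I \<subseteq> J \<and> B \<subseteq> J \<longrightarrow> B = J"
    using finite_has_maximal2[of "{J. indep J \<and> I \<subseteq> J}" I] assms by auto
  then show ?thesis
    using that[of B] indep_subset_ground unfolding basis_def by blast
qed

text \<open>If \<open>X\<close> were dependent, an inclusion-minimal dependent subset of
  \<open>X\<close> would be a circuit.\<close>

lemma (in matroid) indep_if_no_circuit:
  assumes "X \<subseteq> E" "\<And>C. circuit E indep C \<Longrightarrow> \<not> C \<subseteq> X"
  shows "indep X"
proof (rule ccontr)
  assume dep: "\<not> indep X"
  have "finite {D. D \<subseteq> X \<and> \<not> indep D}"
    by (rule finite_subset[of _ "Pow E"]) (use finite_ground assms(1) in auto)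
  then obtain C where C: "C \<subseteq> X" "\<not> indep C"
    and min: "\<forall>D. D \<subseteq> X \<and> \<not> indep D \<and> D \<subseteq> C \<longrightarrow> C = D"
    using finite_has_minimal2[of "{D. D \<subseteq> X \<and> \<not> indep D}" X] dep by auto
  have "circuit E indep C"
    unfolding circuit_def using C min assms(1) by blast
  with C assms(2) show False by blast
qed

text \<open>A nonempty set of extended naturals attains its infimum, so a bound on the covering
  number is witnessed by an actual cover. As \<open>indep\<close> is arbitrary, this serves both for
  a single matroid and for the common independent sets.\<close>

lemma covering_number_le_iff:
  "covering_number E indep \<le> enat n \<longleftrightarrow>
     (\<exists>F. finite F \<and> card F \<le> n \<and> (\<forall>I\<in>F. I \<subseteq> E \<and> indep I) \<and> E \<subseteq> \<Union>F)"
    (is "?L \<longleftrightarrow> ?R")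
proof
  define S where "S = {enat (card F) | F. finite F \<and> (\<forall>I\<in>F. I \<subseteq> E \<and> indep I) \<and> E \<subseteq> \<Union>F}"
  assume ?L
  then have le: "Inf S \<le> enat n" unfolding covering_number_def S_def .
  \<comment> \<open>The infimum of the empty set is infinite, contradicting the finite
    bound.\<close>
  then have "S \<noteq> {}" by (auto simp: top_enat_def)
  then have "Inf S \<in> S" unfolding Inf_enat_def by (auto intro: LeastI)
  then obtain F where "Inf S = enat (card F)" "finite F" "\<forall>I\<in>F. I \<subseteq> E \<and> indep I" "E \<subseteq> \<Union>F"
    unfolding S_def by blast
  with le show ?R by auto
next
  assume ?R
  then obtain F where F: "finite F" "card F \<le> n" "\<forall>I\<in>F. I \<subseteq> E \<and> indep I" "E \<subseteq> \<Union>F"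
    by blast
  then have "covering_number E indep \<le> enat (card F)"
    unfolding covering_number_def by (intro Inf_lower) blast
  then show ?L using F(2) by (meson enat_ord_simps(1) order_trans)
qed

text \<open>Property (R) speaks of pairs of bases, so the independent sets of a two-element cover
  are enlarged to bases.\<close>

lemma (in matroid) ground_eq_Un_bases:
  assumes "covering_number E indep \<le> 2"
  obtains A B where "basis E indep A" "basis E indep B" "E = A \<union> B"
proof -
  have "covering_number E indep \<le> enat 2"
    using assms by (simp add: numeral_eq_enat)
  then obtain F where F: "finite F" "card F \<le> 2" "\<forall>I\<in>F. I \<subseteq> E \<and> indep I" "E \<subseteq> \<Union>F"
    unfolding covering_number_le_iff by blast
  \<comment> \<open>The cover may have fewer than two members: with none, \<open>E\<close> is empty
    and empty sets suffice; with one, that set is used twice.\<close>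
  have "card F = 0 \<or> card F = 1 \<or> card F = 2" using F(2) by linarith
  then have "\<exists>I J. indep I \<and> indep J \<and> E \<subseteq> I \<union> J"
  proof (elim disjE)
    assume "card F = 0"
    with F(1,4) show ?thesis using indep_empty by auto
  next
    assume "card F = 1"
    then obtain I where "F = {I}" by (auto simp: card_1_singleton_iff)
    with F(3,4) show ?thesis by (intro exI[of _ I]) auto
  next
    assume "card F = 2"
    then obtain I J where "F = {I, J}" by (auto simp: card_2_iff)
    with F(3,4) show ?thesis by (intro exI[of _ I] exI[of _ J]) simp
  qed
  then obtain I J where IJ: "indep I" "indep J" "E \<subseteq> I \<union> J" by blast
  obtain A where A: "basis E indep A" "I \<subseteq> A" using indep_extends_to_basis[OF IJ(1)] .
  obtain B where B: "basis E indep B" "J \<subseteq> B" using indep_extends_to_basis[OF IJ(2)] .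
  have "A \<union> B \<subseteq> E" using A(1) B(1) unfolding basis_def by simp
  with A(2) B(2) IJ(3) have "E = A \<union> B" by blast
  with A(1) B(1) show ?thesis by (rule that)
qed

lemma card_set_mset_le_size: "card (set_mset M) \<le> size M"
  by (induction M) (auto simp: card_insert_if)

text \<open>Different \<open>u\<close> give different edges \<open>{u, v}\<close>. Parallel edges
  are counted once on the left but repeatedly in the degree, whence only an inequality.\<close>

lemma card_neighbours_le_degree:
  "card {u \<in> S. {u, v} \<in># G} \<le> degree G v"
proof -
  have "card {u \<in> S. {u, v} \<in># G} \<le> card (set_mset {#e \<in># G. v \<in> e#})"
    by (rule card_inj_on_le[of "\<lambda>u. {u, v}"]) (auto simp: inj_on_def doubleton_eq_iff)
  also have "\<dots> \<le> degree G v"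
    unfolding degree_def by (rule card_set_mset_le_size)
  finally show ?thesis .
qed

text \<open>Greedy colouring: a new vertex has at most \<open>d\<close> coloured neighbours, so one
  of the \<open>d + 1\<close> colours \<open>0, ..., d\<close> is free.\<close>

lemma multigraph_colouring:
  assumes "finite V" "multigraph V G" "\<And>v. v \<in> V \<Longrightarrow> degree G v \<le> d"
  obtains c :: "'a \<Rightarrow> nat" where "\<And>v. v \<in> V \<Longrightarrow> c v \<le> d"
    and "\<And>u v. {u, v} \<in># G \<Longrightarrow> c u \<noteq> c v"
proof -
  have no_loop: "u \<noteq> v" if "{u, v} \<in># G" for u v
    using assms(2) that unfolding multigraph_def by (fastforce simp: doubleton_eq_iff)
  have "\<exists>c. (\<forall>v\<in>S. c v \<le> d) \<and> (\<forall>u\<in>S. \<forall>v\<in>S. {u, v} \<in># G \<longrightarrow> c u \<noteq> c v)"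
    \<comment> \<open>The induction grows the coloured set \<open>S\<close> while \<open>G\<close>
      and its degree bound stay fixed; only edges inside \<open>S\<close> are constrained.\<close>
    if "finite S" "S \<subseteq> V" for S
    using that
  proof (induction S rule: finite_induct)
    case empty
    then show ?case by simp
  next
    case (insert x S)
    then obtain c where c: "\<forall>v\<in>S. c v \<le> d" "\<forall>u\<in>S. \<forall>v\<in>S. {u, v} \<in># G \<longrightarrow> c u \<noteq> c v"
      by blast
    let ?N = "{u \<in> S. {u, x} \<in># G}"
    have "card (c ` ?N) \<le> card ?N"
      using insert.hyps(1) by (intro card_image_le) auto
    also have "\<dots> \<le> d"
      using card_neighbours_le_degree[of S x G] assms(3)[of x] insert.prems by simp
    finally have "card (c ` ?N) < card {..d}" by simp
    then have "\<not> {..d} \<subseteq> c ` ?N"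
      using card_mono[of "c ` ?N" "{..d}"] insert.hyps(1) by auto
    then obtain k where k: "k \<le> d" "k \<notin> c ` ?N" by auto
    have "\<forall>v\<in>insert x S. (c(x := k)) v \<le> d" using c(1) k(1) by simp
    moreover have "(c(x := k)) u \<noteq> (c(x := k)) v"
      if "u \<in> insert x S" "v \<in> insert x S" "{u, v} \<in># G" for u v
      using that c(2) k(2) no_loop[of u v] by (auto simp: insert_commute)
    ultimately show ?case by blast
  qed
  from this[OF assms(1) subset_refl] obtain c :: "'a \<Rightarrow> nat" where
    c: "\<forall>v\<in>V. c v \<le> d" "\<forall>u\<in>V. \<forall>v\<in>V. {u, v} \<in># G \<longrightarrow> c u \<noteq> c v" by blast
  \<comment> \<open>The induction compares colours only for endpoints in \<open>V\<close>; every
    edge has both its endpoints there.\<close>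
  have "u \<in> V \<and> v \<in> V" if "{u, v} \<in># G" for u v
    using assms(2) that unfolding multigraph_def by (fastforce simp: doubleton_eq_iff)
  with c that show ?thesis by blast
qed

lemma multigraph_mono: "multigraph V G \<Longrightarrow> V \<subseteq> W \<Longrightarrow> multigraph W G"
  unfolding multigraph_def by (meson subsetD)

lemma multigraph_sum:
  "finite I \<Longrightarrow> (\<And>i. i \<in> I \<Longrightarrow> multigraph V (G i)) \<Longrightarrow> multigraph V (\<Sum>i\<in>I. G i)"
  by (simp add: multigraph_def set_mset_sum)

lemma degree_sum:
  "finite I \<Longrightarrow> degree (\<Sum>i\<in>I. G i) v = (\<Sum>i\<in>I. degree (G i) v)"
  by (induction I rule: finite_induct) (auto simp: degree_def)

text \<open>When two bases cover \<open>E\<close>, the circuits in their union are all the circuits.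
  The graph from property (R) lives on the symmetric difference of the bases; viewed on all of
  \<open>E\<close>, it leaves the common elements isolated, so 2-regularity becomes maximum degree
  at most 2.\<close>

lemma (in matroid) circuit_covering_graph:
  assumes "covering_number E indep \<le> 2" "property_R E indep"
  obtains G where "multigraph E G" "\<And>v. degree G v \<le> 2" "covers G {C. circuit E indep C}"
proof -
  obtain A B where AB: "basis E indep A" "basis E indep B" "E = A \<union> B"
    using ground_eq_Un_bases assms(1) .
  let ?V = "(A - B) \<union> (B - A)"
  obtain G where G: "two_regular ?V G" "covers G (circuits_in E indep (A \<union> B))"
    using assms(2) AB unfolding property_R_def by blast
  have V: "multigraph ?V G" using G(1) unfolding two_regular_def by blast
  moreover have "?V \<subseteq> E" using AB(3) by blast
  ultimately have "multigraph E G" by (rule multigraph_mono)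
  moreover have "degree G v \<le> 2" for v
  proof (cases "v \<in> ?V")
    case True
    then show ?thesis using G(1) unfolding two_regular_def by simp
  next
    case False
    then have "{#e \<in># G. v \<in> e#} = {#}"
      using V unfolding multigraph_def by (fastforce simp: filter_mset_eq_conv)
    then show ?thesis by (simp only: degree_def) simp
  qed
  moreover have "circuits_in E indep (A \<union> B) = {C. circuit E indep C}"
    using AB(3) unfolding circuits_in_def circuit_def by blast
  ultimately show ?thesis using that[of G] G(2) by simp
qed

theorem theorem25:
  fixes E :: "'a set" and q :: nat and indep :: "nat \<Rightarrow> 'a set \<Rightarrow> bool"
  assumes "\<And>i. i \<in> {1..q} \<Longrightarrow> matroid E (indep i)"
    and "\<And>i. i \<in> {1..q} \<Longrightarrow> loopless_matroid E (indep i)"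
    and "\<And>i. i \<in> {1..q} \<Longrightarrow> covering_number E (indep i) \<le> 2"
    and "\<And>i. i \<in> {1..q} \<Longrightarrow> property_R E (indep i)"
  shows "(\<exists>F. finite F \<and> card F \<le> 2 * q + 1 \<and> E \<subseteq> \<Union>F \<and> (\<forall>I\<in>F. I \<subseteq> E \<and> (\<forall>i\<in>{1..q}. indep i I)))
    \<and> covering_number E (common_indep E q indep) \<le> enat (2 * q + 1)"
proof -
  have "\<exists>F. finite F \<and> card F \<le> 2 * q + 1 \<and> E \<subseteq> \<Union>F \<and> (\<forall>I\<in>F. I \<subseteq> E \<and> (\<forall>i\<in>{1..q}. indep i I))"
  proof (cases "q = 0")
    \<comment> \<open>Without matroids nothing forces \<open>E\<close> to be finite.\<close>
    case True
    then show ?thesis by (intro exI[of _ "{E}"]) simp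
  next
    case False
    then have fin: "finite E"
      using assms(1)[of 1] matroid.finite_ground by fastforce
    have "\<forall>i\<in>{1..q}. \<exists>G. multigraph E G \<and> (\<forall>v. degree G v \<le> 2) \<and> covers G {C. circuit E (indep i) C}"
      using matroid.circuit_covering_graph[OF assms(1,3,4)] by metis
    then obtain G where G: "\<And>i. i \<in> {1..q} \<Longrightarrow> multigraph E (G i)"
        "\<And>i v. i \<in> {1..q} \<Longrightarrow> degree (G i) v \<le> 2"
        "\<And>i. i \<in> {1..q} \<Longrightarrow> covers (G i) {C. circuit E (indep i) C}"
      by metis
    \<comment> \<open>The multiset sum keeps an edge once for each graph containing it, so degrees
      add exactly.\<close>
    let ?G = "\<Sum>i\<in>{1..q}. G i"
    have mem: "e \<in># ?G \<longleftrightarrow> (\<exists>i\<in>{1..q}. e \<in># G i)" for e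
      by (simp add: set_mset_sum)
    have "multigraph E ?G"
      by (rule multigraph_sum) (use G(1) in auto)
    moreover have "degree ?G v \<le> 2 * q" for v
      using sum_bounded_above[of "{1..q}" "\<lambda>i. degree (G i) v" 2] G(2)
      by (simp add: degree_sum mult.commute)
    ultimately obtain c :: "'a \<Rightarrow> nat" where c: "\<And>v. v \<in> E \<Longrightarrow> c v \<le> 2 * q"
      and proper: "\<And>u v. {u, v} \<in># ?G \<Longrightarrow> c u \<noteq> c v"
      using multigraph_colouring[OF fin] by blast
    let ?class = "\<lambda>k. {v \<in> E. c v = k}"
    have "indep i (?class k)" if i: "i \<in> {1..q}" for i k
    proof (rule matroid.indep_if_no_circuit[OF assms(1)[OF i]])
      fix C assume "circuit E (indep i) C"
      then obtain e where e: "e \<in># G i" "e \<subseteq> C"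
        using G(3)[OF i] unfolding covers_def by blast
      then obtain u v where "e = {u, v}"
        using G(1)[OF i] unfolding multigraph_def by blast
      then show "\<not> C \<subseteq> ?class k"
        using e i proper[of u v] mem by blast
    qed simp
    moreover have "card (?class ` {..2 * q}) \<le> 2 * q + 1"
      using card_image_le[of "{..2 * q}" ?class] by simp
    moreover have "E \<subseteq> \<Union>(?class ` {..2 * q})"
      using c by auto
    ultimately show ?thesis
      by (intro exI[of _ "?class ` {..2 * q}"]) blast
  qed
  then show ?thesis
    unfolding covering_number_le_iff common_indep_def by (intro conjI) (assumption, fast)
qed

end
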